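(* Let $\mathbb{K}$ be a field, let $V$ be a vector space over $\mathbb{K}$ with finite positive dimension, let $A, A^*$ be a Leonard pair on $V$, and let $d=\dim V-1$. Let $\theta_0,\ldots,\theta_d$ and $\theta^*_0,\ldots,\theta^*_d$ be the orderings of the eigenvalues of $A$ and $A^*$ described in the context, let $\varphi_1,\ldots,\varphi_d$ and $\phi_1,\ldots,\phi_d$ be respectively the first and second split sequences with respect to the ordering $(\theta_0,\ldots,\theta_d;\theta^*_0,\ldots,\theta^*_d)$, and let $q$ be as in the context. Suppose $d$ is odd. Then $$\det(AA^*-A^*A)=(-1)^{(d+1)/2}\prod_{\substack{1\le i\le d\\ i\text{ odd}}}\frac{\varphi_i\phi_i}{[i]_q^{\,2}}.$$
   Context: A square matrix is tridiagonal if each nonzero entry lies on the diagonal, the subdiagonal or the superdiagonal; a tridiagonal matrix is irreducible if each entry on the subdiagonal is nonzero and each entry on the superdiagonal is nonzero. A Leonard pair on $V$ is an ordered pair of linear transformations $A:V\to V$ and $A^*:V\to V$ such that: (i) there exists a basis for $V$ with respect to which the matrix representing $A$ is irreducible tridiagonal and the matrix representing $A^*$ is diagonal; (ii) there exists a basis for $V$ with respect to which the matrix representing $A^*$ is irreducible tridiagonal and the matrix representing $A$ is diagonal. Here $A^*$ is just a name for a second linear transformation; it does not denote the conjugate-transpose or adjoint of $A$. A matrix $Y$ with rows and columns indexed by $0,\ldots,d$ represents $X:V\to V$ with respect to a basis $u_0,\ldots,u_d$ if $Xu_j=\sum_{i=0}^d Y_{ij}u_i$ for $0\le j\le d$. Eigenvalue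 orderings: fix a basis $v^*_0,\ldots,v^*_d$ satisfying (i), and let $\mathrm{diag}(\theta^*_0,\ldots,\theta^*_d)$ be the matrix representing $A^*$ with respect to it; fix a basis $v_0,\ldots,v_d$ satisfying (ii), and let $\mathrm{diag}(\theta_0,\ldots,\theta_d)$ be the matrix representing $A$ with respect to it. It is known that the $\theta_i$ are mutually distinct and the $\theta^*_i$ are mutually distinct. Split sequences: it is known that there exist nonzero scalars $\varphi_1,\ldots,\varphi_d\in\mathbb{K}$ and a basis of $V$ with respect to which the matrix representing $A$ is lower bidiagonal with diagonal entries $\theta_0,\theta_1,\ldots,\theta_d$ and all subdiagonal entries ($(i,i-1)$-entries, $1\le i\le d$) equal to $1$, and the matrix representing $A^*$ is upper bidiagonal with diagonal entries $\theta^*_0,\theta^*_1,\ldots,\theta^*_d$ and $(i-1,i)$-entry $\varphi_i$ for $1\le i\le d$. The sequence $\varphi_1,\ldots,\varphi_d$ is uniquely determined by the ordering $(\theta_0,\ldots,\theta_d;\theta^*_0,\ldots,\theta^*_d)$ and is called the first split sequence with respect to that ordering. The second split sequence $\phi_1,\ldots,\phi_d$ with respect to $(\theta_0,\ldots,\theta_d;\theta^*_0,\ldots,\theta^*_d)$ is the first split sequence with respect to the ordering $(\theta_d,\theta_{d-1},\ldots,\theta_0;\theta^*_0,\theta^*_1,\ldots,\theta^*_d)$. The scalar $q$: it is known that the expressions $\frac{\theta_{i-2}-\theta_{i+1}}{\theta_{i-1}-\theta_i}$ and $\frac{\theta^*_{i-2}-\theta^*_{i+1}}{\theta^*_{i-1}-\theta^*_i}$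 are equal and independent of $i$ for $2\le i\le d-1$. For $d\ge 3$ let $\beta\in\mathbb{K}$ be the scalar such that $\beta+1$ is this common value; for $d\le 2$ let $\beta$ be any scalar in $\mathbb{K}$. Let $q$ be a nonzero scalar in the algebraic closure $\overline{\mathbb{K}}$ of $\mathbb{K}$ such that $\beta=q^2+q^{-2}$. For an integer $n>0$, $[n]_q=q^{n-1}+q^{n-3}+\cdots+q^{1-n}$. The denominators in the claim are nonzero. *)

theory Defs
  imports
    "HOL-Algebra.Algebraic_Closure_Type"
    "Jordan_Normal_Form.Determinant"
begin

definition irreducible_tridiagonal :: "'a::zero mat \<Rightarrow> bool" where
  "irreducible_tridiagonal Y \<longleftrightarrow>
     square_mat Y \<and>
     (\<forall>i < dim_row Y. \<forall>j < dim_col Y. Y $$ (i, j) \<noteq> 0 \<longrightarrow> i = j \<or> i = j + 1 \<or> j = i + 1) \<and>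
     (\<forall>i. i + 1 < dim_row Y \<longrightarrow> Y $$ (i + 1, i) \<noteq> 0 \<and> Y $$ (i, i + 1) \<noteq> 0)"

text \<open>The \<open>n \<times> n\<close> matrix with diagonal \<open>t 0, \<dots>, t (n - 1)\<close> and all subdiagonal entries \<open>1\<close>.\<close>

definition lower_bidiag :: "nat \<Rightarrow> (nat \<Rightarrow> 'a::zero_neq_one) \<Rightarrow> 'a mat" where
  "lower_bidiag n t = mat n n (\<lambda>(i, j). if i = j then t i else if i = j + 1 then 1 else 0)"

text \<open>The \<open>n \<times> n\<close> matrix with diagonal \<open>t 0, \<dots>, t (n - 1)\<close> and \<open>(i - 1, i)\<close>-entry \<open>p i\<close>
  for \<open>1 \<le> i \<le> n - 1\<close>.\<close>

definition upper_bidiag :: "nat \<Rightarrow> (nat \<Rightarrow> 'a::zero) \<Rightarrow> (nat \<Rightarrow> 'a) \<Rightarrow> 'a mat" where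
  "upper_bidiag n t p = mat n n (\<lambda>(i, j). if i = j then t i else if j = i + 1 then p j else 0)"

definition q_bracket :: "'a::field \<Rightarrow> nat \<Rightarrow> 'a" where
  "q_bracket q n = (\<Sum>k<n. q powi (int n - 1 - 2 * int k))"

text \<open>A copy of \<open>vector_space\<close>, used only so that the constants below are not also interpreted
  for real vector spaces.\<close>

locale linear_space = vector_space scale
  for scale :: "'a::field \<Rightarrow> 'b::ab_group_add \<Rightarrow> 'b"
begin

text \<open>The vector space is the whole type. Bases are indexed by \<open>0, \<dots>, dim UNIV - 1\<close>; values of
  \<open>u\<close> outside this range are irrelevant.\<close>

definition ordered_basis :: "(nat \<Rightarrow> 'b) \<Rightarrow> bool" where
  "ordered_basis u \<longleftrightarrow>
     inj_on u {..<dim UNIV} \<and> independent (u ` {..<dim UNIV}) \<and> span (u ` {..<dim UNIV}) = UNIV"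

definition represents :: "(nat \<Rightarrow> 'b) \<Rightarrow> 'a mat \<Rightarrow> ('b \<Rightarrow> 'b) \<Rightarrow> bool" where
  "represents u Y T \<longleftrightarrow>
     Y \<in> carrier_mat (dim UNIV) (dim UNIV) \<and>
     (\<forall>j < dim UNIV. T (u j) = (\<Sum>i < dim UNIV. scale (Y $$ (i, j)) (u i)))"

text \<open>Determinant of a linear endomorphism; lemma \<open>lin_det_eq\<close> below shows that it can be read off
  from any ordered basis.\<close>

definition lin_det :: "('b \<Rightarrow> 'b) \<Rightarrow> 'a" where
  "lin_det T = (THE c. \<exists>u Y. ordered_basis u \<and> represents u Y T \<and> c = det Y)"

definition tridiagonal_diagonal_basis :: "('b \<Rightarrow> 'b) \<Rightarrow> ('b \<Rightarrow> 'b) \<Rightarrow> (nat \<Rightarrow> 'b) \<Rightarrow> bool" where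
  "tridiagonal_diagonal_basis A B u \<longleftrightarrow>
     ordered_basis u \<and>
     (\<exists>Y. represents u Y A \<and> irreducible_tridiagonal Y) \<and>
     (\<exists>D. represents u D B \<and> diagonal_mat D)"

definition leonard_pair :: "('b \<Rightarrow> 'b) \<Rightarrow> ('b \<Rightarrow> 'b) \<Rightarrow> bool" where
  "leonard_pair A A' \<longleftrightarrow>
     Vector_Spaces.linear scale scale A \<and> Vector_Spaces.linear scale scale A' \<and>
     (\<exists>u. tridiagonal_diagonal_basis A A' u) \<and>
     (\<exists>u. tridiagonal_diagonal_basis A' A u)"

text \<open>In the next two definitions \<open>t\<close> and \<open>t'\<close> are the eigenvalue orderings of \<open>A\<close> and \<open>A'\<close>;
  only the values \<open>p 1, \<dots>, p d\<close> with \<open>d = dim UNIV - 1\<close> matter.\<close>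

definition first_split_sequence ::
  "('b \<Rightarrow> 'b) \<Rightarrow> ('b \<Rightarrow> 'b) \<Rightarrow> (nat \<Rightarrow> 'a) \<Rightarrow> (nat \<Rightarrow> 'a) \<Rightarrow> (nat \<Rightarrow> 'a) \<Rightarrow> bool" where
  "first_split_sequence A A' t t' p \<longleftrightarrow>
     (\<forall>i \<in> {1..dim UNIV - 1}. p i \<noteq> 0) \<and>
     (\<exists>u. ordered_basis u \<and>
        represents u (lower_bidiag (dim UNIV) t) A \<and>
        represents u (upper_bidiag (dim UNIV) t' p) A')"

definition second_split_sequence ::
  "('b \<Rightarrow> 'b) \<Rightarrow> ('b \<Rightarrow> 'b) \<Rightarrow> (nat \<Rightarrow> 'a) \<Rightarrow> (nat \<Rightarrow> 'a) \<Rightarrow> (nat \<Rightarrow> 'a) \<Rightarrow> bool" where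
  "second_split_sequence A A' t t' p \<longleftrightarrow>
     first_split_sequence A A' (\<lambda>i. t (dim UNIV - 1 - i)) t' p"

lemma ordered_basis_coeffs_unique:
  assumes u: "ordered_basis u"
    and eq: "(\<Sum>i < dim UNIV. scale (a i) (u i)) = (\<Sum>i < dim UNIV. scale (b i) (u i))"
    and i: "i < dim UNIV"
  shows "a i = b i"
proof -
  let ?N = "{..<dim (UNIV :: 'b set)}"
  have inj: "inj_on u ?N" and ind: "independent (u ` ?N)"
    using u by (auto simp: ordered_basis_def)
  let ?g = "\<lambda>v. a (the_inv_into ?N u v) - b (the_inv_into ?N u v)"
  have "(\<Sum>v \<in> u ` ?N. scale (?g v) v) = (\<Sum>i \<in> ?N. scale (a i - b i) (u i))"
    by (subst sum.reindex[OF inj]) (simp add: the_inv_into_f_f[OF inj])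
  also have "\<dots> = 0"
    using eq by (simp add: scale_left_diff_distrib sum_subtractf)
  finally have "?g (u i) = 0"
    using independentD[OF ind, of "u ` ?N" ?g "u i"] i by blast
  then show ?thesis
    using i by (simp add: the_inv_into_f_f[OF inj])
qed

lemma ordered_basis_coeffs_exist:
  assumes u: "ordered_basis u"
  shows "\<exists>a. v = (\<Sum>i < dim UNIV. scale (a i) (u i))"
proof -
  let ?N = "{..<dim (UNIV :: 'b set)}"
  have inj: "inj_on u ?N" and sp: "span (u ` ?N) = UNIV"
    using u by (auto simp: ordered_basis_def)
  have "v \<in> range (\<lambda>c. \<Sum>w \<in> u ` ?N. scale (c w) w)"
    using sp span_finite[of "u ` ?N"] by simp
  then obtain c where "v = (\<Sum>w \<in> u ` ?N. scale (c w) w)" by blast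
  also have "\<dots> = (\<Sum>i < dim UNIV. scale (c (u i)) (u i))"
    by (subst sum.reindex[OF inj]) simp
  finally show ?thesis by (intro exI[of _ "\<lambda>i. c (u i)"])
qed

lemma scale_sum_mat_mult:
  assumes P: "P \<in> carrier_mat n n" and Q: "Q \<in> carrier_mat n n" and j: "j < n"
  shows "(\<Sum>k < n. scale (Q $$ (k, j)) (\<Sum>i < n. scale (P $$ (i, k)) (u i)))
       = (\<Sum>i < n. scale ((P * Q) $$ (i, j)) (u i))"
proof -
  have "(P * Q) $$ (i, j) = (\<Sum>k < n. P $$ (i, k) * Q $$ (k, j))" if "i < n" for i
    using P Q j that by (auto simp: scalar_prod_def lessThan_atLeast0 intro!: sum.cong)
  then have "(\<Sum>i < n. scale ((P * Q) $$ (i, j)) (u i))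
     = (\<Sum>i < n. \<Sum>k < n. scale (P $$ (i, k) * Q $$ (k, j)) (u i))"
    by (simp add: scale_sum_left)
  also have "\<dots> = (\<Sum>k < n. \<Sum>i < n. scale (P $$ (i, k) * Q $$ (k, j)) (u i))"
    by (rule sum.swap)
  also have "\<dots> = (\<Sum>k < n. scale (Q $$ (k, j)) (\<Sum>i < n. scale (P $$ (i, k)) (u i)))"
    by (simp add: scale_sum_right mult.commute)
  finally show ?thesis by simp
qed

lemma represents_transition:
  assumes "ordered_basis u"
  shows "\<exists>P \<in> carrier_mat (dim UNIV) (dim UNIV).
           \<forall>j < dim UNIV. w j = (\<Sum>i < dim UNIV. scale (P $$ (i, j)) (u i))"
proof -
  have "\<forall>j. \<exists>a. w j = (\<Sum>i < dim UNIV. scale (a i) (u i))"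
    using ordered_basis_coeffs_exist[OF assms] by blast
  from choice[OF this] obtain c where c: "\<forall>j. w j = (\<Sum>i < dim UNIV. scale (c j i) (u i))"
    by blast
  show ?thesis
    by (rule bexI[of _ "mat (dim UNIV) (dim UNIV) (\<lambda>(i, j). c j i)"]) (simp_all add: c[rule_format])
qed

lemma ordered_basis_mat_eqI:
  assumes u: "ordered_basis u"
    and M: "M \<in> carrier_mat (dim UNIV) (dim UNIV)" and N: "N \<in> carrier_mat (dim UNIV) (dim UNIV)"
    and eq: "\<And>j. j < dim UNIV \<Longrightarrow>
      (\<Sum>i < dim UNIV. scale (M $$ (i, j)) (u i)) = (\<Sum>i < dim UNIV. scale (N $$ (i, j)) (u i))"
  shows "M = N"
proof (rule eq_matI)
  fix i j assume "i < dim_row N" "j < dim_col N"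
  then have "i < dim UNIV" "j < dim UNIV" using N by auto
  then show "M $$ (i, j) = N $$ (i, j)"
    using ordered_basis_coeffs_unique[OF u eq] by blast
qed (use M N in auto)

lemma transition_inverse:
  assumes u: "ordered_basis u"
    and P: "P \<in> carrier_mat (dim UNIV) (dim UNIV)" and Q: "Q \<in> carrier_mat (dim UNIV) (dim UNIV)"
    and wP: "\<And>j. j < dim UNIV \<Longrightarrow> w j = (\<Sum>i < dim UNIV. scale (P $$ (i, j)) (u i))"
    and uQ: "\<And>j. j < dim UNIV \<Longrightarrow> u j = (\<Sum>i < dim UNIV. scale (Q $$ (i, j)) (w i))"
  shows "P * Q = 1\<^sub>m (dim UNIV)"
proof (rule ordered_basis_mat_eqI[OF u])
  let ?n = "dim (UNIV :: 'b set)"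
  show "P * Q \<in> carrier_mat ?n ?n" using P Q by simp
  show "1\<^sub>m ?n \<in> carrier_mat ?n ?n" by simp
  fix j assume j: "j < ?n"
  have "(\<Sum>i < ?n. scale ((P * Q) $$ (i, j)) (u i)) = (\<Sum>k < ?n. scale (Q $$ (k, j)) (w k))"
    by (subst scale_sum_mat_mult[OF P Q j, symmetric]) (simp add: wP)
  also have "\<dots> = u j" using uQ[OF j] by simp
  also have "\<dots> = (\<Sum>i < ?n. if i = j then u i else 0)" using j by simp
  also have "\<dots> = (\<Sum>i < ?n. scale ((1\<^sub>m ?n) $$ (i, j)) (u i))"
    using j by (intro sum.cong) auto
  finally show "(\<Sum>i < ?n. scale ((P * Q) $$ (i, j)) (u i))
      = (\<Sum>i < ?n. scale ((1\<^sub>m ?n) $$ (i, j)) (u i))" .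
qed

lemma lin_det_eq:
  assumes lin: "Vector_Spaces.linear scale scale T"
    and u: "ordered_basis u" and Y: "represents u Y T"
  shows "lin_det T = det Y"
  unfolding lin_det_def
proof (rule the_equality)
  show "\<exists>u' Y'. ordered_basis u' \<and> represents u' Y' T \<and> det Y = det Y'" using u Y by blast
next
  let ?n = "dim (UNIV :: 'b set)"
  interpret T: Vector_Spaces.linear scale scale T by (rule lin)
  fix c assume "\<exists>w Z. ordered_basis w \<and> represents w Z T \<and> c = det Z"
  then obtain w Z where w: "ordered_basis w" and Z: "represents w Z T" and c: "c = det Z" by blast
  have Yc: "Y \<in> carrier_mat ?n ?n" and Zc: "Z \<in> carrier_mat ?n ?n"
    using Y Z by (auto simp: represents_def)
  obtain P where P: "P \<in> carrier_mat ?n ?n"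
    and wP: "\<And>j. j < ?n \<Longrightarrow> w j = (\<Sum>i < ?n. scale (P $$ (i, j)) (u i))"
    using represents_transition[OF u, of w] by blast
  obtain Q where Q: "Q \<in> carrier_mat ?n ?n"
    and uQ: "\<And>j. j < ?n \<Longrightarrow> u j = (\<Sum>i < ?n. scale (Q $$ (i, j)) (w i))"
    using represents_transition[OF w, of u] by blast
  have PQ: "P * Q = 1\<^sub>m ?n" by (rule transition_inverse[OF u P Q wP uQ])
  have QP: "Q * P = 1\<^sub>m ?n" by (rule transition_inverse[OF w Q P uQ wP])
  have "Y * P = P * Z"
  proof (rule ordered_basis_mat_eqI[OF u])
    fix j assume j: "j < ?n"
    have "(\<Sum>i < ?n. scale ((Y * P) $$ (i, j)) (u i)) = (\<Sum>k < ?n. scale (P $$ (k, j)) (T (u k)))"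
      using Y by (subst scale_sum_mat_mult[OF Yc P j, symmetric]) (simp add: represents_def)
    also have "\<dots> = T (w j)" by (simp add: wP[OF j] T.sum T.scale)
    also have "\<dots> = (\<Sum>k < ?n. scale (Z $$ (k, j)) (w k))"
      using Z j by (simp add: represents_def)
    also have "\<dots> = (\<Sum>i < ?n. scale ((P * Z) $$ (i, j)) (u i))"
      by (subst scale_sum_mat_mult[OF P Zc j, symmetric]) (simp add: wP)
    finally show "(\<Sum>i < ?n. scale ((Y * P) $$ (i, j)) (u i))
        = (\<Sum>i < ?n. scale ((P * Z) $$ (i, j)) (u i))" .
  qed (use P Yc Zc in auto)
  then have "Y * P * Q = P * Z * Q" by simp
  moreover have "Y * P * Q = Y" using assoc_mult_mat[OF Yc P Q] PQ Yc by simp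
  ultimately have "Y = P * Z * Q" by metis
  then have "similar_mat Y Z"
    using P Q PQ QP Yc Zc unfolding similar_mat_def similar_mat_wit_def Let_def
    by (intro exI[of _ P] exI[of _ Q]) auto
  then show "c = det Y" using c det_similar by metis
qed

end

end

theory Submission
  imports Defs
begin

text \<open>
  In the basis of eigenvectors of \<open>A'\<close>, the matrix of \<open>A'\<close> is \<open>diag (\<theta>' 0, \<dots>, \<theta>' d)\<close> and the matrix
  \<open>Y\<close> of \<open>A\<close> is irreducible tridiagonal. The commutator has entries \<open>(\<theta>' j - \<theta>' i) * Y i j\<close>, so it is
  tridiagonal with zero diagonal. Its size \<open>d + 1\<close> is even, and the only permutation that
  contributes to its determinant swaps \<open>i - 1\<close> and \<open>i\<close> for each odd \<open>i\<close>. The determinant is therefore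
  the product, over odd \<open>i\<close>, of \<open>(\<theta>' i - \<theta>' (i - 1))\<^sup>2 * Y (i - 1) i * Y i (i - 1)\<close>.

  The products \<open>Y (i - 1) i * Y i (i - 1)\<close> are found from two eigenvectors of \<open>Y\<close>, both for the
  eigenvalue \<open>\<theta> 0\<close>. The functional that reads off the first coordinate in the first split basis is a
  left eigenvector \<open>f\<close>; the last vector of the second split basis, in which the order of the \<open>\<theta> i\<close> is
  reversed, is a right eigenvector \<open>g\<close>. Since \<open>A'\<close> is upper bidiagonal in both split bases, with
  diagonal \<open>\<theta>'\<close>, the transition matrices to the eigenbasis of \<open>A'\<close> are upper triangular, and their
  entries are products of split parameters over products of differences \<open>\<theta>' j - \<theta>' h\<close>
  (\<open>split_basis_left_eigenvector\<close>, \<open>split_basis_right_eigenvector\<close>). For a tridiagonal matrix a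
  left and a right eigenvector with the same eigenvalue determine the ratio of the two
  off-diagonal entries (\<open>tridiagonal_left_right_eigenvector\<close>). Combining these facts,
  \<open>Y (i - 1) i * Y i (i - 1)\<close> is the product of the \<open>i\<close>-th entries of the two split sequences and an
  explicit quotient of products of differences of the \<open>\<theta>' h\<close>
  (\<open>tridiagonal_entries_from_split_sequences\<close>).

  It remains to evaluate this quotient for all odd \<open>i\<close> together. The recurrence with parameter \<open>\<beta>\<close>
  gives a factorization \<open>\<theta>' i - \<theta>' j = F (i - j) * S (i + j)\<close> (\<open>gap_factorization\<close>) in which
  \<open>F n\<close> is the bracket \<open>[n]\<close> for odd \<open>n\<close>. Multiplied by
  \<open>(\<theta>' i - \<theta>' (i - 1))\<^sup>2\<close>, the quotient telescopes to
  \<open>- S (i - 1) * S (d + i) / (F i * F (d - i + 1) * S (2 * i - 2) * S (2 * i))\<close>. In the product over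
  odd \<open>i\<close>, numerator and denominator contain the same values of \<open>S\<close>, namely those at the even
  numbers from \<open>0\<close> to \<open>2 * d\<close>, and \<open>F i\<close> and \<open>F (d - i + 1)\<close> run through the same brackets.
\<close>

section \<open>Determinants of tridiagonal matrices with zero diagonal\<close>

text \<open>The only nonzero entry of the first row is in column \<open>1\<close>; once row \<open>0\<close> and column \<open>1\<close> are
  deleted, the only nonzero entry of the first column is the one that was in row \<open>1\<close>. Two Laplace
  expansions thus split off the first \<open>2 \<times> 2\<close> block.\<close>

lemma det_tridiagonal_zero_diagonal:
  fixes f :: "nat \<Rightarrow> nat \<Rightarrow> 'a::comm_ring_1"
  assumes "\<And>i j. i < 2 * m \<Longrightarrow> j < 2 * m \<Longrightarrow> i \<noteq> j + 1 \<Longrightarrow> j \<noteq> i + 1 \<Longrightarrow> f i j = 0"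
  shows "det (mat (2 * m) (2 * m) (\<lambda>(i, j). f i j)) =
    (\<Prod>k<m. - (f (2 * k) (2 * k + 1) * f (2 * k + 1) (2 * k)))"
  using assms
proof (induction m arbitrary: f)
  case 0
  then show ?case by (simp add: det_dim_zero)
next
  case (Suc m)
  let ?n = "2 * Suc m"
  let ?M = "mat ?n ?n (\<lambda>(i, j). f i j)"
  let ?N = "mat_delete ?M 0 1"
  let ?g = "\<lambda>i j. f (i + 2) (j + 2)"
  have M: "?M \<in> carrier_mat ?n ?n" by simp
  have N: "?N \<in> carrier_mat (2 * m + 1) (2 * m + 1)"
    using mat_delete_carrier[OF M, of 0 1] by simp
  have f0: "f 0 j = 0" if "j < ?n" "j \<noteq> 1" for j
    using Suc.prems[of 0 j] that by simp
  have "det ?M = (\<Sum>j<?n. ?M $$ (0, j) * cofactor ?M 0 j)"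
    by (rule laplace_expansion_row[OF M]) simp
  also have "\<dots> = (\<Sum>j<?n. if j = 1 then f 0 1 * cofactor ?M 0 1 else 0)"
    by (intro sum.cong) (auto simp: f0)
  also have "\<dots> = - (f 0 1 * det ?N)"
    by (subst sum.delta) (simp_all add: cofactor_def)
  also have "det ?N = (\<Sum>i<2 * m + 1. ?N $$ (i, 0) * cofactor ?N i 0)"
    by (rule laplace_expansion_column[OF N]) simp
  also have "\<dots> = (\<Sum>i<2 * m + 1. if i = 0 then f 1 0 * cofactor ?N 0 0 else 0)"
    using Suc.prems by (intro sum.cong) (auto simp: mat_delete_def)
  also have "\<dots> = f 1 0 * det (mat_delete ?N 0 0)"
    by (subst sum.delta) (simp_all add: cofactor_def)
  also have "mat_delete ?N 0 0 = mat (2 * m) (2 * m) (\<lambda>(i, j). ?g i j)"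
    by (rule eq_matI) (auto simp: mat_delete_def)
  also have "det \<dots> = (\<Prod>k<m. - (?g (2 * k) (2 * k + 1) * ?g (2 * k + 1) (2 * k)))"
    using Suc.prems by (intro Suc.IH) auto
  finally show ?case
    by (simp add: prod.lessThan_Suc_shift del: prod.lessThan_Suc)
qed

section \<open>Eigenvalue sequences satisfying a three-term recurrence\<close>

text \<open>For \<open>b = q\<^sup>2 + 1 / q\<^sup>2\<close> this is the bracket \<open>[n]\<close> if \<open>n\<close> is odd and \<open>[n] / [2]\<close> if \<open>n\<close> is even.
  Both are polynomials in \<open>b\<close>, so they lie in the base field, and the even values make sense
  when \<open>[2] = 0\<close> as well.\<close>

fun gap_factor :: "'a::comm_ring_1 \<Rightarrow> nat \<Rightarrow> 'a" where
  "gap_factor b 0 = 0"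
| "gap_factor b (Suc 0) = 1"
| "gap_factor b (Suc (Suc 0)) = 1"
| "gap_factor b (Suc (Suc (Suc 0))) = b + 1"
| "gap_factor b (Suc (Suc (Suc (Suc n)))) = b * gap_factor b (Suc (Suc n)) - gap_factor b n"

lemma q_bracket_recurrence:
  fixes q :: "'a::field"
  assumes q: "q \<noteq> 0"
  shows "(q powi 2 + q powi (- 2)) * q_bracket q (n + 2) = q_bracket q (n + 4) + q_bracket q n"
proof -
  let ?r = "q powi (- 1 - int n) + q powi (- int n - 3)"
  have shift: "(q powi 2 + q powi (- 2)) * q powi a = q powi (a + 2) + q powi (a - 2)" for a :: int
    using q by (simp add: power_int_add power_int_diff power_int_minus field_simps)
  have "(q powi 2 + q powi (- 2)) * q_bracket q (n + 2)
      = (\<Sum>k<n + 2. q powi (int n + 3 - 2 * int k)) + (\<Sum>k<n + 2. q powi (int n - 1 - 2 * int k))"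
    unfolding q_bracket_def sum_distrib_left sum.distrib[symmetric]
    by (intro sum.cong refl, subst shift) (simp add: algebra_simps)
  moreover have "q_bracket q (n + 4) = (\<Sum>k<n + 2. q powi (int n + 3 - 2 * int k)) + ?r"
    by (simp add: q_bracket_def numeral_eq_Suc add.assoc algebra_simps)
  moreover have "(\<Sum>k<n + 2. q powi (int n - 1 - 2 * int k)) = q_bracket q n + ?r"
    by (simp add: q_bracket_def numeral_eq_Suc add.assoc algebra_simps)
  ultimately show ?thesis by simp
qed

lemma to_ac_gap_factor_odd:
  assumes q: "q \<noteq> 0" and b: "to_ac b = q powi 2 + q powi (- 2)" and "odd n"
  shows "to_ac (gap_factor b n) = q_bracket q n"
  using b \<open>odd n\<close>
proof (induction b n rule: gap_factor.induct)
  case (5 b n)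
  have "q_bracket q (Suc (Suc (Suc (Suc n)))) =
      (q powi 2 + q powi (- 2)) * q_bracket q (Suc (Suc n)) - q_bracket q n"
    using q_bracket_recurrence[OF q, of n] by (simp add: eval_nat_numeral)
  with 5 show ?case by simp
qed (auto simp: q_bracket_def eval_nat_numeral)

text \<open>The hypothesis says that \<open>t (i + 1) - b * t i + t (i - 1)\<close> does not depend on \<open>i\<close>. Hence, with the
  midpoint of \<open>j\<close> and \<open>j + n\<close> kept fixed, the gaps \<open>t (j + n) - t j\<close> satisfy the recurrence of
  \<open>gap_factor b n\<close> in \<open>n\<close>. The second factor is the innermost gap with that midpoint: the one with
  \<open>n = 1\<close> or \<open>n = 2\<close>, according to parity.\<close>

lemma gap_factorization:
  fixes t :: "nat \<Rightarrow> 'a::comm_ring_1"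
  assumes rec: "\<And>i. 2 \<le> i \<Longrightarrow> i + 1 \<le> d \<Longrightarrow> t (i - 2) - t (i + 1) = (b + 1) * (t (i - 1) - t i)"
    and "j + n \<le> d"
  shows "t (j + n) - t j =
    gap_factor b n * (t ((2 * j + n + 2) div 2) - t ((2 * j + n - 1) div 2))"
proof -
  define c where "c i = t (i + 1) - b * t i + t (i - 1)" for i
  have c_const: "c i = c 1" if "1 \<le> i" "i + 1 \<le> d" for i
    using that
  proof (induction i rule: nat_induct_at_least)
    case (Suc i)
    have "c (Suc i) = c i"
      using rec[of "Suc i"] Suc.hyps Suc.prems by (simp add: c_def algebra_simps)
    then show ?case using Suc by simp
  qed simp
  show ?thesis
    using rec \<open>j + n \<le> d\<close> c_const unfolding c_def
proof (induction b n arbitrary: j rule: gap_factor.induct)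
  case (4 b)
  have halves: "(2 * j + Suc (Suc (Suc 0)) + 2) div 2 = j + 2"
    "(2 * j + Suc (Suc (Suc 0)) - 1) div 2 = j + 1" by simp_all
  from 4(1)[of "j + 2"] 4(2) show ?case unfolding halves
    by (simp add: numeral_3_eq_3 algebra_simps)
next
  case (5 b n)
  let ?m = "2 * j + Suc (Suc (Suc (Suc n)))"
  let ?s = "t ((?m + 2) div 2) - t ((?m - 1) div 2)"
  have shift: "2 * (j + 1) + Suc (Suc n) = ?m" "2 * (j + 2) + n = ?m" by simp_all
  have "t (j + Suc (Suc (Suc (Suc n)))) - t j =
      b * (t (j + 1 + Suc (Suc n)) - t (j + 1)) - (t (j + 2 + n) - t (j + 2))"
  proof -
    have "t (j + n + 4) - b * t (j + n + 3) + t (j + n + 2) = t (j + 2) - b * t (j + 1) + t j"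
      using 5(4) trans[OF 5(5)[of "j + n + 3"] 5(5)[of "j + 1", symmetric]]
      by (simp add: eval_nat_numeral)
    then show ?thesis by (simp add: eval_nat_numeral algebra_simps)
  qed
  also have "t (j + 1 + Suc (Suc n)) - t (j + 1) = gap_factor b (Suc (Suc n)) * ?s"
    unfolding shift(1)[symmetric] using 5(3-5) by (intro 5(1)) auto
  also have "t (j + 2 + n) - t (j + 2) = gap_factor b n * ?s"
    unfolding shift(2)[symmetric] using 5(3-5) by (intro 5(2)) auto
  finally show ?case by (simp add: left_diff_distrib mult.assoc)
qed auto
qed


text \<open>These identities evaluate \<open>\<Prod> (t i - t h) / (t (i - 1) - t h)\<close> over \<open>h < i - 1\<close>, and the
  corresponding product over \<open>h > i\<close>. Passing from \<open>i - 1\<close> to \<open>i\<close> shifts the arguments of \<open>F\<close> and \<open>S\<close>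
  by one, so each product telescopes.\<close>

lemma eigenvalue_ratio_telescope:
  fixes t F S :: "nat \<Rightarrow> 'a::comm_ring_1"
  assumes t: "\<And>i j. j < i \<Longrightarrow> i \<le> d \<Longrightarrow> t i - t j = F (i - j) * S (i + j)"
    and F1: "F 1 = 1" and i: "1 \<le> i" "i \<le> d"
  shows "(\<Prod>h<i - 1. t (i - 1) - t h) * (t i - t (i - 1)) * F i * S (2 * i - 2) =
      (\<Prod>h<i. t i - t h) * S (i - 1)" (is ?lower)
    and "(\<Prod>h\<in>{i<..d}. t i - t h) * (t (i - 1) - t i) * F (d - i + 1) * S (2 * i) =
      (\<Prod>h\<in>{i - 1<..d}. t (i - 1) - t h) * S (d + i)" (is ?upper)
proof -
  have "(\<Prod>h<k. t (i - 1) - t h) * F i * S (i - 1 + k) =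
      (\<Prod>h<k. t i - t h) * F (i - k) * S (i - 1)" if "k \<le> i - 1" for k
    using that
  proof (induction k)
    case (Suc k)
    have *: "t (i - 1) - t k = F (i - Suc k) * S (i - 1 + k)"
      "t i - t k = F (i - k) * S (i - 1 + Suc k)"
      using t[of k "i - 1"] t[of k i] Suc.prems i by simp_all
    have "(\<Prod>h<Suc k. t (i - 1) - t h) * F i * S (i - 1 + Suc k) =
        ((\<Prod>h<k. t (i - 1) - t h) * F i * S (i - 1 + k)) * F (i - Suc k) * S (i - 1 + Suc k)"
      unfolding prod.lessThan_Suc * by (simp only: mult_ac)
    also have "\<dots> = (\<Prod>h<Suc k. t i - t h) * F (i - Suc k) * S (i - 1)"
      unfolding prod.lessThan_Suc * Suc.IH[OF Suc_leD[OF Suc.prems]] by (simp only: mult_ac)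
    finally show ?case .
  qed simp
  from this[of "i - 1"] have lower: "(\<Prod>h<i - 1. t (i - 1) - t h) * F i * S (2 * i - 2) =
      (\<Prod>h<i - 1. t i - t h) * S (i - 1)"
    using i F1 by (simp add: mult_2 numeral_2_eq_2)
  have "(\<Prod>h<i - 1. t (i - 1) - t h) * (t i - t (i - 1)) * F i * S (2 * i - 2) =
      ((\<Prod>h<i - 1. t (i - 1) - t h) * F i * S (2 * i - 2)) * (t i - t (i - 1))"
    by (simp only: mult_ac)
  also have "\<dots> = (\<Prod>h<i - 1. t i - t h) * (t i - t (i - 1)) * S (i - 1)"
    unfolding lower by (simp only: mult_ac)
  also have "(\<Prod>h<i - 1. t i - t h) * (t i - t (i - 1)) = (\<Prod>h<i. t i - t h)"
    using prod.lessThan_Suc[of "\<lambda>h. t i - t h" "i - 1"] i by simp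
  finally show ?lower .

  have "(\<Prod>r<k. t i - t (i + 1 + r)) * F (k + 1) * S (2 * i) =
      (\<Prod>r<k. t (i - 1) - t (i + 1 + r)) * S (2 * i + k)" if "k \<le> d - i" for k
    using that
  proof (induction k)
    case (Suc k)
    have *: "t i - t (i + 1 + k) = - (F (k + 1) * S (2 * i + Suc k))"
      "t (i - 1) - t (i + 1 + k) = - (F (Suc k + 1) * S (2 * i + k))"
    proof -
      have index: "i + 1 + k + i = 2 * i + Suc k" "i + 1 + k + (i - 1) = 2 * i + k"
        "i + 1 + k - i = k + 1" "i + 1 + k - (i - 1) = Suc k + 1" "i + 1 + k \<le> d"
        using Suc.prems i by simp_all
      have "t (i + 1 + k) - t i = F (k + 1) * S (2 * i + Suc k)"
        by (rule t[of i "i + 1 + k", OF _ index(5), unfolded index(1,3)]) simp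
      then show "t i - t (i + 1 + k) = - (F (k + 1) * S (2 * i + Suc k))"
        by (metis minus_diff_eq)
      have "t (i + 1 + k) - t (i - 1) = F (Suc k + 1) * S (2 * i + k)"
        by (rule t[of "i - 1" "i + 1 + k", OF _ index(5), unfolded index(2,4)]) simp
      then show "t (i - 1) - t (i + 1 + k) = - (F (Suc k + 1) * S (2 * i + k))"
        by (metis minus_diff_eq)
    qed
    have "(\<Prod>r<Suc k. t i - t (i + 1 + r)) * F (Suc k + 1) * S (2 * i) =
        ((\<Prod>r<k. t i - t (i + 1 + r)) * F (k + 1) * S (2 * i)) *
        (- (F (Suc k + 1) * S (2 * i + Suc k)))"
      unfolding prod.lessThan_Suc * by (simp add: mult_ac)
    also have "\<dots> = (\<Prod>r<Suc k. t (i - 1) - t (i + 1 + r)) * S (2 * i + Suc k)"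
      unfolding prod.lessThan_Suc * Suc.IH[OF Suc_leD[OF Suc.prems]] by (simp add: mult_ac)
    finally show ?case .
  qed (simp add: F1[unfolded One_nat_def])
  from this[of "d - i"] have "(\<Prod>r<d - i. t i - t (i + 1 + r)) * F (d - i + 1) * S (2 * i) =
      (\<Prod>r<d - i. t (i - 1) - t (i + 1 + r)) * S (d + i)"
    using i by (simp add: mult_2 add.commute[of d i])
  moreover have reindex: "(\<Prod>h\<in>{i<..d}. g h) = (\<Prod>r<d - i. g (i + 1 + r))" for g :: "nat \<Rightarrow> 'a"
    by (rule prod.reindex_bij_witness[of _ "\<lambda>r. i + 1 + r" "\<lambda>h. h - i - 1"]) auto
  ultimately have upper: "(\<Prod>h\<in>{i<..d}. t i - t h) * F (d - i + 1) * S (2 * i) =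
      (\<Prod>h\<in>{i<..d}. t (i - 1) - t h) * S (d + i)"
    by (simp only: reindex)
  have "(\<Prod>h\<in>{i<..d}. t i - t h) * (t (i - 1) - t i) * F (d - i + 1) * S (2 * i) =
      ((\<Prod>h\<in>{i<..d}. t i - t h) * F (d - i + 1) * S (2 * i)) * (t (i - 1) - t i)"
    by (simp only: mult_ac)
  also have "\<dots> = (t (i - 1) - t i) * (\<Prod>h\<in>{i<..d}. t (i - 1) - t h) * S (d + i)"
    unfolding upper by (simp only: mult_ac)
  also have "\<dots> = (\<Prod>h\<in>{i - 1<..d}. t (i - 1) - t h) * S (d + i)"
  proof -
    have "{i - 1<..d} = insert i {i<..d}" using i by auto
    then show ?thesis by simp
  qed
  finally show ?upper .
qed

lemma prod_split_lessThan:
  fixes g :: "nat \<Rightarrow> 'a::comm_monoid_mult"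
  shows "(\<Prod>k<m + n. g k) = (\<Prod>k<m. g k) * (\<Prod>k<n. g (m + k))"
  by (induction n) (simp_all add: mult_ac)

text \<open>Both sides are the product of \<open>S\<close> over the even numbers below \<open>4 * m\<close>: on the left grouped
  modulo \<open>4\<close>, on the right into a lower and an upper half.\<close>

lemma prod_doubling_cancel:
  fixes S :: "nat \<Rightarrow> 'a::comm_monoid_mult"
  shows "(\<Prod>k<m. S (4 * k) * S (4 * k + 2)) = (\<Prod>k<m. S (2 * k) * S (2 * m + 2 * k))"
proof -
  have "(\<Prod>k<m. S (4 * k) * S (4 * k + 2)) = (\<Prod>j<2 * m. S (2 * j))"
    by (induction m) (simp_all add: mult_ac)
  also have "\<dots> = (\<Prod>k<m. S (2 * k)) * (\<Prod>k<m. S (2 * (m + k)))"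
    unfolding mult_2[of m] by (rule prod_split_lessThan)
  finally show ?thesis by (simp add: prod.distrib distrib_left)
qed

text \<open>Multiplying the hypothesis on \<open>R i\<close> by both telescoped identities removes all products of gaps
  and leaves \<open>R i * F i * F (d - i + 1) * S (2 * i - 2) * S (2 * i) = - c i * S (i - 1) * S (d + i)\<close>,
  where \<open>d = 2 * m + 1\<close>. In the product over odd \<open>i\<close> the values of \<open>S\<close> cancel by
  \<open>prod_doubling_cancel\<close>, and \<open>i \<mapsto> d - i + 1\<close> permutes the odd indices.\<close>

lemma prod_odd_eigenvalue_ratios:
  fixes t R c :: "nat \<Rightarrow> 'a::field"
  assumes inj: "inj_on t {..2 * m + 1}"
    and rec: "\<And>i. 2 \<le> i \<Longrightarrow> i \<le> 2 * m \<Longrightarrow> t (i - 2) - t (i + 1) = (b + 1) * (t (i - 1) - t i)"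
    and R: "\<And>i. 1 \<le> i \<Longrightarrow> i \<le> 2 * m + 1 \<Longrightarrow>
      R i * (\<Prod>h<i. t i - t h) * (\<Prod>h\<in>{i - 1<..2 * m + 1}. t (i - 1) - t h) =
      c i * (t i - t (i - 1))\<^sup>2 *
        (\<Prod>h<i - 1. t (i - 1) - t h) * (\<Prod>h\<in>{i<..2 * m + 1}. t i - t h)"
  shows "(\<Prod>k<m + 1. R (2 * k + 1)) * (\<Prod>k<m + 1. (gap_factor b (2 * k + 1))\<^sup>2) =
      (\<Prod>k<m + 1. - c (2 * k + 1))" (is ?prod)
    and "k \<le> m \<Longrightarrow> gap_factor b (2 * k + 1) \<noteq> 0"
proof -
  define d where "d = 2 * m + 1"
  \<comment> \<open>\<open>S (2 * d)\<close> would refer to the undefined \<open>t (d + 1)\<close>. It is never the factor of a gap, so any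
    nonzero value will do; \<open>S 0\<close> is \<open>t 1 - t 0\<close>, because subtraction truncates.\<close>
  define S where "S l = (if l = 2 * d then 1 else t ((l + 2) div 2) - t ((l - 1) div 2))" for l
  let ?F = "gap_factor b"
  have t_neq: "t i \<noteq> t j" if "i \<le> d" "j \<le> d" "i \<noteq> j" for i j
    using inj_onD[OF inj, of i j] that by (auto simp: d_def)
  have factor: "t i - t j = ?F (i - j) * S (i + j)" if "j < i" "i \<le> d" for i j
  proof -
    have "2 * j + (i - j) = i + j" using that by simp
    then show ?thesis
      using gap_factorization[of d t b j "i - j"] rec that by (simp add: S_def d_def add.commute[of i j])
  qed
  have S: "S l \<noteq> 0" if "l \<le> 2 * d" for l
  proof (cases "l = 2 * d")
    case False
    then have "(l + 2) div 2 \<le> d" "(l - 1) div 2 < (l + 2) div 2" using that by linarith+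
    then show ?thesis using False t_neq by (simp add: S_def)
  qed (simp add: S_def)
  have each: "R i * ?F i * ?F (d - i + 1) * (S (2 * i - 2) * S (2 * i)) = - c i * (S (i - 1) * S (d + i))"
    if i: "1 \<le> i" "i \<le> d" for i
  proof -
    have cancel: "x * u * v * (y * z) = - w * (a * e)"
      if "l1 * g * u * y = l * a" "r * (- g) * v * z = r1 * e" "x * l * r1 = w * g\<^sup>2 * l1 * r" "l * r1 \<noteq> 0"
      for a e g l l1 r r1 u v w x y z :: 'a
    proof -
      have "(l * r1) * (x * u * v * (y * z)) = (w * g\<^sup>2 * l1 * r) * (u * v * (y * z))"
        unfolding that(3)[symmetric] by (simp only: mult_ac)
      also have "\<dots> = - (w * (l1 * g * u * y) * (r * (- g) * v * z))"
        by (simp add: power2_eq_square mult_ac)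
      also have "\<dots> = (l * r1) * (- w * (a * e))"
        unfolding that(1,2) by (simp add: mult_ac)
      finally show ?thesis by (rule mult_left_cancel[OF that(4), THEN iffD1])
    qed
    have "?F 1 = 1" by simp
    note telescope = eigenvalue_ratio_telescope[of d t ?F S i, OF factor this i]
    have upper: "(\<Prod>h\<in>{i<..d}. t i - t h) * - (t i - t (i - 1)) * ?F (d - i + 1) * S (2 * i) =
        (\<Prod>h\<in>{i - 1<..d}. t (i - 1) - t h) * S (d + i)"
      unfolding minus_diff_eq by (rule telescope(2))
    have "(\<Prod>h<i. t i - t h) * (\<Prod>h\<in>{i - 1<..d}. t (i - 1) - t h) \<noteq> 0"
      using t_neq i by auto
    from cancel[OF telescope(1) upper R[folded d_def, OF i] this] show ?thesis .
  qed
  have F: "?F (2 * k + 1) \<noteq> 0" if "k \<le> m" for k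
    using factor[of 0 "2 * k + 1"] t_neq[of "2 * k + 1" 0] that by (auto simp: d_def)
  then show "k \<le> m \<Longrightarrow> gap_factor b (2 * k + 1) \<noteq> 0" .
  let ?SS = "\<Prod>k<m + 1. S (4 * k) * S (4 * k + 2)"
  have "(\<Prod>k<m + 1. R (2 * k + 1) * ?F (2 * k + 1) * ?F (2 * (m - k) + 1)) * ?SS =
      (\<Prod>k<m + 1. R (2 * k + 1) * ?F (2 * k + 1) * ?F (2 * (m - k) + 1) *
        (S (4 * k) * S (4 * k + 2)))"
    by (rule prod.distrib[symmetric])
  also have "\<dots> = (\<Prod>k<m + 1. - c (2 * k + 1) * (S (2 * k) * S (2 * (m + 1) + 2 * k)))"
  proof (intro prod.cong refl)
    fix k assume "k \<in> {..<m + 1}"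
    then have k: "1 \<le> 2 * k + 1" "2 * k + 1 \<le> d" and index: "2 * (2 * k + 1) = 4 * k + 2"
      "4 * k + 2 - 2 = 4 * k" "2 * k + 1 - 1 = 2 * k" "d + (2 * k + 1) = 2 * (m + 1) + 2 * k"
      "d - (2 * k + 1) + 1 = 2 * (m - k) + 1"
      by (auto simp: d_def)
    show "R (2 * k + 1) * ?F (2 * k + 1) * ?F (2 * (m - k) + 1) * (S (4 * k) * S (4 * k + 2)) =
        - c (2 * k + 1) * (S (2 * k) * S (2 * (m + 1) + 2 * k))"
      using each[OF k] unfolding index .
  qed
  also have "\<dots> = (\<Prod>k<m + 1. - c (2 * k + 1)) * ?SS"
    unfolding prod_doubling_cancel by (rule prod.distrib)
  finally have "(\<Prod>k<m + 1. R (2 * k + 1) * ?F (2 * k + 1) * ?F (2 * (m - k) + 1)) * ?SS =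
      (\<Prod>k<m + 1. - c (2 * k + 1)) * ?SS" .
  moreover have "?SS \<noteq> 0"
    using S by (auto simp: d_def)
  ultimately have "(\<Prod>k<m + 1. R (2 * k + 1) * ?F (2 * k + 1) * ?F (2 * (m - k) + 1)) =
      (\<Prod>k<m + 1. - c (2 * k + 1))"
    by (simp only: mult_right_cancel not_False_eq_True)
  moreover have "(\<Prod>k<m + 1. ?F (2 * (m - k) + 1)) = (\<Prod>k<m + 1. ?F (2 * k + 1))"
    by (rule prod.reindex_bij_witness[of _ "\<lambda>k. m - k" "\<lambda>k. m - k"]) auto
  ultimately show ?prod
    by (simp only: prod.distrib power2_eq_square mult.assoc)
qed

section \<open>Eigenvectors of an irreducible tridiagonal matrix\<close>

lemma sum_adjacent:
  fixes c :: "nat \<Rightarrow> 'a::comm_monoid_add"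
  assumes "j < n"
    and "\<And>k. k < n \<Longrightarrow> k \<noteq> j \<Longrightarrow> k \<noteq> j + 1 \<Longrightarrow> j \<noteq> k + 1 \<Longrightarrow> c k = 0"
  shows "(\<Sum>k<n. c k) =
    (if j = 0 then 0 else c (j - 1)) + c j + (if j + 1 < n then c (j + 1) else 0)"
proof -
  have "(\<Sum>k<n. c k) = (\<Sum>k<n. (if k = j - 1 then if j = 0 then 0 else c (j - 1) else 0) +
      (if k = j then c j else 0) + (if k = j + 1 then c (j + 1) else 0))"
    using assms by (intro sum.cong) (auto split: if_splits)
  also have "\<dots> = (if j = 0 then 0 else c (j - 1)) + c j + (if j + 1 < n then c (j + 1) else 0)"
    using assms(1) by (cases "j = 0") (simp_all add: sum.distrib less_imp_diff_less)
  finally show ?thesis .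
qed

lemma index_mult_mat_sum:
  assumes "A \<in> carrier_mat n n" "B \<in> carrier_mat n n" "i < n" "j < n"
  shows "(A * B) $$ (i, j) = (\<Sum>k<n. A $$ (i, k) * B $$ (k, j))"
  using assms by (auto simp: scalar_prod_def lessThan_atLeast0 intro!: sum.cong)

lemma irreducible_tridiagonalD:
  assumes "irreducible_tridiagonal Y" "Y \<in> carrier_mat n n"
  shows "i < n \<Longrightarrow> j < n \<Longrightarrow> i \<noteq> j \<Longrightarrow> i \<noteq> j + 1 \<Longrightarrow> j \<noteq> i + 1 \<Longrightarrow> Y $$ (i, j) = 0"
    and "i + 1 < n \<Longrightarrow> Y $$ (i + 1, i) \<noteq> 0"
    and "i + 1 < n \<Longrightarrow> Y $$ (i, i + 1) \<noteq> 0"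
  using assms unfolding irreducible_tridiagonal_def by auto

text \<open>Row \<open>i\<close> of the eigenvalue equation determines \<open>x (i + 1)\<close> from \<open>x i\<close> and \<open>x (i - 1)\<close>, since the
  superdiagonal entry is nonzero.\<close>

lemma tridiagonal_eigenvector_head_zero:
  fixes Y :: "'a::field mat"
  assumes Y: "Y \<in> carrier_mat n n" "irreducible_tridiagonal Y"
    and x: "\<And>i. i < n \<Longrightarrow> (\<Sum>k<n. Y $$ (i, k) * x k) = l * x i"
    and "x 0 = 0" and "i < n"
  shows "x i = 0"
  using \<open>i < n\<close>
proof (induction i rule: less_induct)
  case (less i)
  show ?case
  proof (cases i)
    case (Suc j)
    have "(\<Sum>k<n. Y $$ (j, k) * x k) = Y $$ (j, j + 1) * x (j + 1)"
      using less Suc irreducible_tridiagonalD(1)[OF Y(2,1)]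
      by (subst sum_adjacent[of j]) auto
    moreover have "x j = 0" using less Suc by simp
    ultimately show ?thesis
      using x[of j] irreducible_tridiagonalD(3)[OF Y(2,1), of j] less.prems Suc by simp
  qed (simp add: assms)
qed

text \<open>Eigenspaces are one-dimensional: two independent eigenvectors with the same eigenvalue have a
  nonzero combination whose first coordinate vanishes.\<close>

lemma tridiagonal_eigenvalues_distinct:
  fixes Y :: "'a::field mat"
  assumes Y: "Y \<in> carrier_mat n n" "irreducible_tridiagonal Y"
    and P: "P \<in> carrier_mat n n" and Q: "Q \<in> carrier_mat n n" and QP: "Q * P = 1\<^sub>m n"
    and eig: "Y * P = P * mat_diag n t"
  shows "inj_on t {..<n}"
proof (rule inj_onI, rule ccontr)
  fix i j assume ij: "i \<in> {..<n}" "j \<in> {..<n}" "t i = t j" "i \<noteq> j"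
  have col: "(\<Sum>k<n. Y $$ (h, k) * P $$ (k, c)) = t c * P $$ (h, c)" if "h < n" "c < n" for h c
    using arg_cong[OF eig, of "\<lambda>M. M $$ (h, c)"] index_mult_mat_sum[OF Y(1) P] that
    by (simp add: mat_diag_mult_right[OF P])
  have inv: "(\<Sum>k<n. Q $$ (i, k) * P $$ (k, c)) = (if i = c then 1 else 0)" if "c < n" for c
    using index_mult_mat_sum[OF Q P, of i c] ij that QP by simp
  let ?x = "\<lambda>k. P $$ (0, j) * P $$ (k, i) - P $$ (0, i) * P $$ (k, j)"
  have "(\<Sum>k<n. Y $$ (h, k) * ?x k) = t i * ?x h" if h: "h < n" for h
  proof -
    have "(\<Sum>k<n. Y $$ (h, k) * ?x k) =
        P $$ (0, j) * (\<Sum>k<n. Y $$ (h, k) * P $$ (k, i)) -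
        P $$ (0, i) * (\<Sum>k<n. Y $$ (h, k) * P $$ (k, j))"
      by (simp add: sum_distrib_left sum_subtractf algebra_simps)
    also have "\<dots> = t i * ?x h" 
      using ij by (simp only: col[OF h] lessThan_iff) (simp add: right_diff_distrib mult_ac)
    finally show ?thesis .
  qed
  then have x0: "?x k = 0" if "k < n" for k
    using tridiagonal_eigenvector_head_zero[OF Y, of ?x "t i" k] that by simp
  have "P $$ (0, j) = P $$ (0, j) * (\<Sum>k<n. Q $$ (i, k) * P $$ (k, i)) -
      P $$ (0, i) * (\<Sum>k<n. Q $$ (i, k) * P $$ (k, j))"
    using ij by (simp add: inv)
  also have "\<dots> = (\<Sum>k<n. Q $$ (i, k) * ?x k)"
    by (simp add: sum_distrib_left sum_subtractf algebra_simps)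
  also have "\<dots> = 0" using x0 by simp
  finally have "P $$ (0, j) = 0" .
  then have "P $$ (k, j) = 0" if "k < n" for k
    using tridiagonal_eigenvector_head_zero[OF Y, of "\<lambda>k. P $$ (k, j)" "t j" k] col that ij by auto
  moreover have "(\<Sum>k<n. Q $$ (j, k) * P $$ (k, j)) = 1"
    using index_mult_mat_sum[OF Q P, of j j] ij QP by simp
  ultimately show False by simp
qed

text \<open>Multiply equation \<open>j\<close> for \<open>f\<close> by \<open>g j\<close> and equation \<open>j\<close> for \<open>g\<close> by \<open>f j\<close> and subtract: the diagonal
  entries and the eigenvalue drop out, and the difference of the two sides of the claim is the same
  for \<open>j\<close> as for \<open>j - 1\<close>. It is zero at the boundary.\<close>

lemma tridiagonal_left_right_eigenvector:
  fixes Y :: "'a::field mat"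
  assumes Y: "Y \<in> carrier_mat n n" "irreducible_tridiagonal Y"
    and f: "\<And>j. j < n \<Longrightarrow> (\<Sum>k<n. f k * Y $$ (k, j)) = l * f j"
    and g: "\<And>j. j < n \<Longrightarrow> (\<Sum>k<n. Y $$ (j, k) * g k) = l * g j"
    and "j + 1 < n"
  shows "f (j + 1) * g j * Y $$ (j + 1, j) = Y $$ (j, j + 1) * f j * g (j + 1)"
  using \<open>j + 1 < n\<close>
proof (induction j)
  case 0
  have "(\<Sum>k<n. f k * Y $$ (k, 0)) = f 0 * Y $$ (0, 0) + f 1 * Y $$ (1, 0)"
    "(\<Sum>k<n. Y $$ (0, k) * g k) = Y $$ (0, 0) * g 0 + Y $$ (0, 1) * g 1"
    using 0 irreducible_tridiagonalD(1)[OF Y(2,1)] by (subst sum_adjacent[of 0]; auto)+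
  then have "f 0 * Y $$ (0, 0) + f 1 * Y $$ (1, 0) = l * f 0"
    "Y $$ (0, 0) * g 0 + Y $$ (0, 1) * g 1 = l * g 0"
    using f[of 0] g[of 0] 0 by auto
  moreover have "b * c * z = w * a * e" if "a * y + b * z = l * a" "y * c + w * e = l * c"
    for a b c e w y z :: 'a
    using that by Groebner_Basis.algebra
  ultimately show ?case by simp
next
  case (Suc j)
  have "(\<Sum>k<n. f k * Y $$ (k, Suc j)) =
      f j * Y $$ (j, Suc j) + f (Suc j) * Y $$ (Suc j, Suc j) + f (Suc j + 1) * Y $$ (Suc j + 1, Suc j)"
    "(\<Sum>k<n. Y $$ (Suc j, k) * g k) =
      Y $$ (Suc j, j) * g j + Y $$ (Suc j, Suc j) * g (Suc j) + Y $$ (Suc j, Suc j + 1) * g (Suc j + 1)"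
    using Suc.prems irreducible_tridiagonalD(1)[OF Y(2,1)]
    by (subst sum_adjacent[of "Suc j"]; auto)+
  then have
    "f j * Y $$ (j, Suc j) + f (Suc j) * Y $$ (Suc j, Suc j) + f (Suc j + 1) * Y $$ (Suc j + 1, Suc j)
      = l * f (Suc j)"
    "Y $$ (Suc j, j) * g j + Y $$ (Suc j, Suc j) * g (Suc j) + Y $$ (Suc j, Suc j + 1) * g (Suc j + 1)
      = l * g (Suc j)"
    using f[of "Suc j"] g[of "Suc j"] Suc.prems by auto
  moreover have "f (Suc j) * g j * Y $$ (Suc j, j) = Y $$ (j, Suc j) * f j * g (Suc j)"
    using Suc by simp
  ultimately show ?case by Groebner_Basis.algebra
qed

section \<open>Split bases\<close>

lemma upper_triangular_invertible_diag_nonzero: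
  fixes P :: "'a::field mat"
  assumes P: "P \<in> carrier_mat n n" and Q: "Q \<in> carrier_mat n n" and PQ: "P * Q = 1\<^sub>m n"
    and tri: "\<And>i j. j < i \<Longrightarrow> i < n \<Longrightarrow> P $$ (i, j) = 0" and i: "i < n"
  shows "P $$ (i, i) \<noteq> 0"
proof
  assume "P $$ (i, i) = 0"
  then have "0 \<in> set (diag_mat P)" using P i by (force simp: diag_mat_def)
  moreover have "det P = prod_list (diag_mat P)"
    using P tri by (intro det_upper_triangular[of _ n]) auto
  ultimately have "det P = 0" by (simp add: prod_list_zero_iff)
  then show False using det_mult[OF P Q] PQ by simp
qed

lemma bidiag_mult_entries:
  fixes P :: "'a::comm_ring_1 mat"
  assumes P: "P \<in> carrier_mat n n" and ij: "i < n" "j < n"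
  shows "(P * lower_bidiag n s) $$ (i, j) =
      P $$ (i, j) * s j + (if j + 1 < n then P $$ (i, j + 1) else 0)"
    and "(lower_bidiag n s * P) $$ (i, j) =
      s i * P $$ (i, j) + (if i = 0 then 0 else P $$ (i - 1, j))"
    and "(P * upper_bidiag n t p) $$ (i, j) =
      P $$ (i, j) * t j + (if j = 0 then 0 else P $$ (i, j - 1) * p j)"
    and "(upper_bidiag n t p * P) $$ (i, j) =
      t i * P $$ (i, j) + (if i + 1 < n then p (i + 1) * P $$ (i + 1, j) else 0)"
proof -
  have L: "lower_bidiag n s \<in> carrier_mat n n" and U: "upper_bidiag n t p \<in> carrier_mat n n"
    by (simp_all add: lower_bidiag_def upper_bidiag_def)
  show "(P * lower_bidiag n s) $$ (i, j) =
      P $$ (i, j) * s j + (if j + 1 < n then P $$ (i, j + 1) else 0)"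
    unfolding index_mult_mat_sum[OF P L ij] using ij
    by (subst sum_adjacent[of j]) (auto simp: lower_bidiag_def)
  show "(lower_bidiag n s * P) $$ (i, j) =
      s i * P $$ (i, j) + (if i = 0 then 0 else P $$ (i - 1, j))"
    unfolding index_mult_mat_sum[OF L P ij] using ij
    by (subst sum_adjacent[of i]) (auto simp: lower_bidiag_def)
  show "(P * upper_bidiag n t p) $$ (i, j) =
      P $$ (i, j) * t j + (if j = 0 then 0 else P $$ (i, j - 1) * p j)"
    unfolding index_mult_mat_sum[OF P U ij] using ij
    by (subst sum_adjacent[of j]) (auto simp: upper_bidiag_def)
  show "(upper_bidiag n t p * P) $$ (i, j) =
      t i * P $$ (i, j) + (if i + 1 < n then p (i + 1) * P $$ (i + 1, j) else 0)"
    unfolding index_mult_mat_sum[OF U P ij] using ij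
    by (subst sum_adjacent[of i]) (auto simp: upper_bidiag_def)
qed

text \<open>The columns of \<open>P\<close> are the vectors of a split basis in coordinates for which the second map is
  diagonal. The last column is an eigenvector \<open>g\<close> of \<open>Y\<close>, because the lower bidiagonal matrix has
  only its diagonal entry in the last column. Row \<open>i\<close> of the equation for \<open>t\<close> is a first-order
  recurrence, whose solution is
  \<open>P i (n - 1) = P i i * \<Prod> p h / \<Prod> (t i - t h)\<close> with \<open>h\<close> running from \<open>i + 1\<close> to \<open>n - 1\<close>. The
  normalization \<open>P i i\<close> disappears from the final identity, because the ratio of consecutive
  diagonal entries of \<open>P\<close> is a subdiagonal entry of \<open>Y\<close>.\<close>

lemma split_basis_right_eigenvector:
  fixes Y :: "'a::field mat"
  assumes Y: "Y \<in> carrier_mat n n" "irreducible_tridiagonal Y"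
    and P: "P \<in> carrier_mat n n" and Q: "Q \<in> carrier_mat n n" and PQ: "P * Q = 1\<^sub>m n"
    and YP: "Y * P = P * lower_bidiag n s"
    and DP: "mat_diag n t * P = P * upper_bidiag n t p"
    and t: "inj_on t {..<n}" and p: "\<forall>i\<in>{1..<n}. p i \<noteq> 0"
  obtains g where "\<And>j. j < n \<Longrightarrow> (\<Sum>k<n. Y $$ (j, k) * g k) = s (n - 1) * g j"
    and "\<And>j. j < n \<Longrightarrow> g j \<noteq> 0"
    and "\<And>j. 1 \<le> j \<Longrightarrow> j < n \<Longrightarrow>
      g (j - 1) * Y $$ (j, j - 1) * (\<Prod>h\<in>{j - 1<..n - 1}. t (j - 1) - t h) =
      p j * g j * (\<Prod>h\<in>{j<..n - 1}. t j - t h)"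
proof
  have rec: "t i * P $$ (i, j) = P $$ (i, j) * t j + (if j = 0 then 0 else P $$ (i, j - 1) * p j)"
    if "i < n" "j < n" for i j
    using arg_cong[OF DP, of "\<lambda>M. M $$ (i, j)"] bidiag_mult_entries(3)[OF P that] that
    by (simp add: mat_diag_mult_left[OF P])
  have t_neq: "t i \<noteq> t j" if "i < n" "j < n" "i \<noteq> j" for i j
    using inj_onD[OF t, of i j] that by auto
  have tri: "P $$ (i, j) = 0" if "j < i" "i < n" for i j
    using that
  proof (induction j)
    case 0
    then show ?case using rec[of i 0] t_neq[of i 0] by (auto simp: mult.commute)
  next
    case (Suc j)
    then show ?case using rec[of i "Suc j"] t_neq[of i "Suc j"] by (auto simp: mult.commute)
  qed
  have diag: "P $$ (i, i) \<noteq> 0" if "i < n" for i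
    by (rule upper_triangular_invertible_diag_nonzero[OF P Q PQ tri that])
  have sub: "Y $$ (j, j - 1) * P $$ (j - 1, j - 1) = P $$ (j, j)" if "1 \<le> j" "j < n" for j
  proof -
    have "(\<Sum>k<n. Y $$ (j, k) * P $$ (k, j - 1)) = Y $$ (j, j - 1) * P $$ (j - 1, j - 1)"
      using that tri irreducible_tridiagonalD(1)[OF Y(2,1)]
      by (subst sum_adjacent[of j]) auto
    moreover have "(\<Sum>k<n. Y $$ (j, k) * P $$ (k, j - 1)) = P $$ (j, j)"
      using arg_cong[OF YP, of "\<lambda>M. M $$ (j, j - 1)"] index_mult_mat_sum[OF Y(1) P, of j "j - 1"]
        bidiag_mult_entries(1)[OF P, of j "j - 1" s] tri[of "j - 1" j] that
      by simp
    ultimately show ?thesis by simp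
  qed
  have row: "P $$ (i, i + k) * (\<Prod>h\<in>{i<..i + k}. t i - t h) = P $$ (i, i) * (\<Prod>h\<in>{i<..i + k}. p h)"
    if "i + k < n" for i k
    using that
  proof (induction k)
    case (Suc k)
    have ring: "x * (u * a) = w * (r * b)" if "x * u = y * r" "y * a = w * b"
      for a b r u w x y :: 'a
      using that by Groebner_Basis.algebra
    have "{i<..i + Suc k} = insert (i + Suc k) {i<..i + k}" by auto
    then have last: "(\<Prod>h\<in>{i<..i + Suc k}. e h) = e (i + Suc k) * (\<Prod>h\<in>{i<..i + k}. e h)"
      for e :: "nat \<Rightarrow> 'a"
      by simp
    have step: "P $$ (i, i + Suc k) * (t i - t (i + Suc k)) = P $$ (i, i + k) * p (i + Suc k)"
      using rec[of i "i + Suc k"] Suc.prems by (simp add: algebra_simps)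
    have "i + k < n" using Suc.prems by simp
    from ring[OF step Suc.IH[OF this]] show ?case unfolding last .
  qed simp
  define g where "g i = P $$ (i, n - 1)" for i
  have g: "g i * (\<Prod>h\<in>{i<..n - 1}. t i - t h) = P $$ (i, i) * (\<Prod>h\<in>{i<..n - 1}. p h)"
    if "i < n" for i
    using row[of i "n - 1 - i"] that by (simp add: g_def)
  show "(\<Sum>k<n. Y $$ (j, k) * g k) = s (n - 1) * g j" if "j < n" for j
    using arg_cong[OF YP, of "\<lambda>M. M $$ (j, n - 1)"] index_mult_mat_sum[OF Y(1) P, of j "n - 1"]
      bidiag_mult_entries(1)[OF P, of j "n - 1" s] that
    by (simp add: g_def mult.commute)
  show "g j \<noteq> 0" if "j < n" for j
  proof -
    have "P $$ (j, j) * (\<Prod>h\<in>{j<..n - 1}. p h) \<noteq> 0"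
      using diag[OF that] p by auto
    then show ?thesis using g[OF that] by auto
  qed
  show "g (j - 1) * Y $$ (j, j - 1) * (\<Prod>h\<in>{j - 1<..n - 1}. t (j - 1) - t h) =
      p j * g j * (\<Prod>h\<in>{j<..n - 1}. t j - t h)" if "1 \<le> j" "j < n" for j
  proof -
    have ring: "x * y * a = r * z * b" if "x * a = c * (r * e)" "z * b = h * e" "y * c = h"
      for a b c e h r x y z :: 'a
      using that by Groebner_Basis.algebra
    have "{j - 1<..n - 1} = insert j {j<..n - 1}" using that by auto
    then have "(\<Prod>h\<in>{j - 1<..n - 1}. p h) = p j * (\<Prod>h\<in>{j<..n - 1}. p h)" by simp
    then have "g (j - 1) * (\<Prod>h\<in>{j - 1<..n - 1}. t (j - 1) - t h) =
        P $$ (j - 1, j - 1) * (p j * (\<Prod>h\<in>{j<..n - 1}. p h))"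
      using g[of "j - 1"] that by simp
    from ring[OF this g[OF that(2)] sub[OF that]] show ?thesis .
  qed
qed

text \<open>The counterpart for the inverse transition matrix \<open>Q\<close>: its first row is a left eigenvector of
  \<open>Y\<close>, and now the recurrence runs along the columns of \<open>Q\<close>.\<close>

lemma split_basis_left_eigenvector:
  fixes Y :: "'a::field mat"
  assumes Y: "Y \<in> carrier_mat n n" "irreducible_tridiagonal Y"
    and P: "P \<in> carrier_mat n n" and Q: "Q \<in> carrier_mat n n" and QP: "Q * P = 1\<^sub>m n"
    and QY: "Q * Y = lower_bidiag n s * Q"
    and QD: "Q * mat_diag n t = upper_bidiag n t p * Q"
    and t: "inj_on t {..<n}" and p: "\<forall>i\<in>{1..<n}. p i \<noteq> 0"
  obtains f where "\<And>j. j < n \<Longrightarrow> (\<Sum>k<n. f k * Y $$ (k, j)) = s 0 * f j"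
    and "\<And>j. j < n \<Longrightarrow> f j \<noteq> 0"
    and "\<And>j. 1 \<le> j \<Longrightarrow> j < n \<Longrightarrow>
      f j * Y $$ (j, j - 1) * (\<Prod>h<j. t j - t h) = p j * f (j - 1) * (\<Prod>h<j - 1. t (j - 1) - t h)"
proof
  have rec: "Q $$ (i, j) * t j = t i * Q $$ (i, j) + (if i + 1 < n then p (i + 1) * Q $$ (i + 1, j) else 0)"
    if "i < n" "j < n" for i j
    using arg_cong[OF QD, of "\<lambda>M. M $$ (i, j)"] bidiag_mult_entries(4)[OF Q that] that
    by (simp add: mat_diag_mult_right[OF Q])
  have t_neq: "t i \<noteq> t j" if "i < n" "j < n" "i \<noteq> j" for i j
    using inj_onD[OF t, of i j] that by auto
  have tri: "Q $$ (i, j) = 0" if "j < i" "i < n" for i j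
    using that
  proof (induction "n - i" arbitrary: i rule: less_induct)
    case less
    have "i + 1 < n \<Longrightarrow> Q $$ (i + 1, j) = 0" using less by simp
    then show ?case using rec[of i j] t_neq[of i j] less.prems by (auto simp: mult.commute split: if_splits)
  qed
  have diag: "Q $$ (i, i) \<noteq> 0" if "i < n" for i
    by (rule upper_triangular_invertible_diag_nonzero[OF Q P QP tri that])
  have sub: "Q $$ (j, j) * Y $$ (j, j - 1) = Q $$ (j - 1, j - 1)" if "1 \<le> j" "j < n" for j
  proof -
    have "(\<Sum>k<n. Q $$ (j, k) * Y $$ (k, j - 1)) = Q $$ (j, j) * Y $$ (j, j - 1)"
      using that tri irreducible_tridiagonalD(1)[OF Y(2,1)]
      by (subst sum_adjacent[of "j - 1"]) auto
    moreover have "(\<Sum>k<n. Q $$ (j, k) * Y $$ (k, j - 1)) = Q $$ (j - 1, j - 1)"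
      using arg_cong[OF QY, of "\<lambda>M. M $$ (j, j - 1)"] index_mult_mat_sum[OF Q Y(1), of j "j - 1"]
        bidiag_mult_entries(2)[OF Q, of j "j - 1" s] tri[of "j - 1" j] that
      by simp
    ultimately show ?thesis by simp
  qed
  have col: "Q $$ (j - k, j) * (\<Prod>h\<in>{j - k..<j}. t j - t h) = Q $$ (j, j) * (\<Prod>h\<in>{j - k<..j}. p h)"
    if "k \<le> j" "j < n" for j k
    using that
  proof (induction k)
    case (Suc k)
    define i where "i = j - Suc k"
    have i: "j - k = i + 1" "i < j" using Suc.prems by (auto simp: i_def)
    have ring: "x * (u * a) = w * (r * b)" if "x * u = r * y" "y * a = w * b"
      for a b r u w x y :: 'a
      using that by Groebner_Basis.algebra
    have "{i..<j} = insert i {i + 1..<j}" "{i<..j} = insert (i + 1) {i + 1<..j}" using i by auto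
    then have first: "(\<Prod>h\<in>{i..<j}. e h) = e i * (\<Prod>h\<in>{i + 1..<j}. e h)"
        "(\<Prod>h\<in>{i<..j}. e h) = e (i + 1) * (\<Prod>h\<in>{i + 1<..j}. e h)"
      for e :: "nat \<Rightarrow> 'a"
      by simp_all
    have step: "Q $$ (i, j) * (t j - t i) = p (i + 1) * Q $$ (i + 1, j)"
      using rec[of i j] Suc.prems i by (simp add: algebra_simps)
    have "k \<le> j" using Suc.prems by simp
    from ring[OF step Suc.IH[OF this Suc.prems(2), unfolded i(1)]]
    show ?case unfolding i_def[symmetric] first .
  qed simp
  define f where "f j = Q $$ (0, j)" for j
  have f: "f j * (\<Prod>h<j. t j - t h) = Q $$ (j, j) * (\<Prod>h\<in>{0<..j}. p h)" if "j < n" for j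
    using col[of j j] that by (simp add: f_def lessThan_atLeast0)
  show "(\<Sum>k<n. f k * Y $$ (k, j)) = s 0 * f j" if "j < n" for j
    using arg_cong[OF QY, of "\<lambda>M. M $$ (0, j)"] index_mult_mat_sum[OF Q Y(1), of 0 j]
      bidiag_mult_entries(2)[OF Q, of 0 j s] that
    by (simp add: f_def)
  show "f j \<noteq> 0" if "j < n" for j
  proof -
    have "Q $$ (j, j) * (\<Prod>h\<in>{0<..j}. p h) \<noteq> 0"
      using diag[OF that] p that by auto
    then show ?thesis using f[OF that] by auto
  qed
  show "f j * Y $$ (j, j - 1) * (\<Prod>h<j. t j - t h) = p j * f (j - 1) * (\<Prod>h<j - 1. t (j - 1) - t h)"
    if "1 \<le> j" "j < n" for j
  proof -
    have ring: "x * y * a = r * z * b" if "x * a = h * (r * e)" "z * b = c * e" "h * y = c"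
      for a b c e h r x y z :: 'a
      using that by Groebner_Basis.algebra
    have "{0<..j} = insert j {0<..j - 1}" using that by auto
    then have "(\<Prod>h\<in>{0<..j}. p h) = p j * (\<Prod>h\<in>{0<..j - 1}. p h)" using that by simp
    then have "f j * (\<Prod>h<j. t j - t h) = Q $$ (j, j) * (p j * (\<Prod>h\<in>{0<..j - 1}. p h))"
      using f[of j] that by simp
    from ring[OF this f[of "j - 1"] sub[OF that]] show ?thesis using that by simp
  qed
qed

section \<open>The commutator of a Leonard pair\<close>

context linear_space
begin

lemma change_of_basis:
  assumes u: "ordered_basis u" and w: "ordered_basis w"
  obtains P Q where "P \<in> carrier_mat (dim UNIV) (dim UNIV)" "Q \<in> carrier_mat (dim UNIV) (dim UNIV)"
    "P * Q = 1\<^sub>m (dim UNIV)" "Q * P = 1\<^sub>m (dim UNIV)"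
    "\<And>T Y Z. Vector_Spaces.linear scale scale T \<Longrightarrow> represents u Y T \<Longrightarrow> represents w Z T \<Longrightarrow>
      Y * P = P * Z \<and> Q * Y = Z * Q"
proof -
  let ?n = "dim (UNIV :: 'b set)"
  obtain P where P: "P \<in> carrier_mat ?n ?n"
    and wP: "\<And>j. j < ?n \<Longrightarrow> w j = (\<Sum>i < ?n. scale (P $$ (i, j)) (u i))"
    using represents_transition[OF u, of w] by blast
  obtain Q where Q: "Q \<in> carrier_mat ?n ?n"
    and uQ: "\<And>j. j < ?n \<Longrightarrow> u j = (\<Sum>i < ?n. scale (Q $$ (i, j)) (w i))"
    using represents_transition[OF w, of u] by blast
  have PQ: "P * Q = 1\<^sub>m ?n" by (rule transition_inverse[OF u P Q wP uQ])
  have QP: "Q * P = 1\<^sub>m ?n" by (rule transition_inverse[OF w Q P uQ wP])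
  have "Y * P = P * Z \<and> Q * Y = Z * Q"
    if T: "Vector_Spaces.linear scale scale T" and Y: "represents u Y T" and Z: "represents w Z T"
    for T Y Z
  proof
    interpret T: Vector_Spaces.linear scale scale T by (rule T)
    have Yc: "Y \<in> carrier_mat ?n ?n" and Zc: "Z \<in> carrier_mat ?n ?n"
      using Y Z by (auto simp: represents_def)
    show YP: "Y * P = P * Z"
    proof (rule ordered_basis_mat_eqI[OF u])
      fix j assume j: "j < ?n"
      have "(\<Sum>i < ?n. scale ((Y * P) $$ (i, j)) (u i)) = (\<Sum>k < ?n. scale (P $$ (k, j)) (T (u k)))"
        using Y by (subst scale_sum_mat_mult[OF Yc P j, symmetric]) (simp add: represents_def)
      also have "\<dots> = T (w j)" by (simp add: wP[OF j] T.sum T.scale)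
      also have "\<dots> = (\<Sum>k < ?n. scale (Z $$ (k, j)) (w k))"
        using Z j by (simp add: represents_def)
      also have "\<dots> = (\<Sum>i < ?n. scale ((P * Z) $$ (i, j)) (u i))"
        by (subst scale_sum_mat_mult[OF P Zc j, symmetric]) (simp add: wP)
      finally show "(\<Sum>i < ?n. scale ((Y * P) $$ (i, j)) (u i)) =
          (\<Sum>i < ?n. scale ((P * Z) $$ (i, j)) (u i))" .
    qed (use P Yc Zc in auto)
    have "Q * Y = Q * (Y * (P * Q))" using Yc PQ by simp
    also have "\<dots> = Q * (Y * P) * Q" 
      by (simp add: assoc_mult_mat[OF Yc P Q] assoc_mult_mat[OF Q mult_carrier_mat[OF Yc P] Q])
    also have "\<dots> = (Q * P) * Z * Q" by (simp add: YP assoc_mult_mat[OF Q P Zc])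
    finally show "Q * Y = Z * Q" using QP Zc by simp
  qed
  with P Q PQ QP show thesis by (rule that) auto
qed

lemma represents_commutator:
  assumes A: "Vector_Spaces.linear scale scale A" and A': "Vector_Spaces.linear scale scale A'"
    and Y: "represents u Y A" and D: "represents u (mat_diag (dim UNIV) t) A'"
  shows "represents u (mat (dim UNIV) (dim UNIV) (\<lambda>(i, j). (t j - t i) * Y $$ (i, j)))
    (\<lambda>x. A (A' x) - A' (A x))"
  unfolding represents_def
proof (intro conjI allI impI)
  let ?n = "dim (UNIV :: 'b set)"
  interpret A: Vector_Spaces.linear scale scale A by (rule A)
  interpret A': Vector_Spaces.linear scale scale A' by (rule A')
  have A'u: "A' (u j) = scale (t j) (u j)" if "j < ?n" for j
  proof -
    have "A' (u j) = (\<Sum>i < ?n. scale (mat_diag ?n t $$ (i, j)) (u i))"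
      using D that by (simp add: represents_def)
    also have "\<dots> = (\<Sum>i < ?n. if i = j then scale (t j) (u j) else 0)"
      using that by (intro sum.cong) (auto simp: mat_diag_def)
    finally show ?thesis using that by simp
  qed
  fix j assume j: "j < ?n"
  have Au: "A (u j) = (\<Sum>i < ?n. scale (Y $$ (i, j)) (u i))"
    using Y j by (simp add: represents_def)
  have "A (A' (u j)) - A' (A (u j)) =
      (\<Sum>i < ?n. scale (t j) (scale (Y $$ (i, j)) (u i)) - scale (Y $$ (i, j)) (scale (t i) (u i)))"
    using j by (simp add: A'u A.scale A'.sum A'.scale Au sum_subtractf scale_sum_right)
  also have "\<dots> = (\<Sum>i < ?n. scale ((t j - t i) * Y $$ (i, j)) (u i))"
    by (simp add: scale_left_diff_distrib left_diff_distrib mult.commute)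
  finally show "A (A' (u j)) - A' (A (u j)) = (\<Sum>i < ?n.
      scale (mat ?n ?n (\<lambda>(i, j). (t j - t i) * Y $$ (i, j)) $$ (i, j)) (u i))"
    using j by simp
qed simp

lemma linear_commutator:
  assumes A: "Vector_Spaces.linear scale scale A" and A': "Vector_Spaces.linear scale scale A'"
  shows "Vector_Spaces.linear scale scale (\<lambda>x. A (A' x) - A' (A x))"
proof -
  interpret A: Vector_Spaces.linear scale scale A by (rule A)
  interpret A': Vector_Spaces.linear scale scale A' by (rule A')
  show ?thesis
    by unfold_locales (simp_all add: A.add A'.add A.scale A'.scale algebra_simps
        scale_right_diff_distrib)
qed

lemma leonard_pair_eigenvalues_distinct:
  assumes lin: "Vector_Spaces.linear scale scale A'"
    and basis_ii: "tridiagonal_diagonal_basis A' A v"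
    and v': "ordered_basis v'" and D: "represents v' (mat_diag (dim UNIV) t) A'"
  shows "inj_on t {..<dim (UNIV :: 'b set)}"
proof -
  obtain Z where v: "ordered_basis v" and Z: "represents v Z A'" "irreducible_tridiagonal Z"
    using basis_ii by (auto simp: tridiagonal_diagonal_basis_def)
  obtain P Q where PQ: "P \<in> carrier_mat (dim UNIV) (dim UNIV)" "Q \<in> carrier_mat (dim UNIV) (dim UNIV)"
      "P * Q = 1\<^sub>m (dim UNIV)" "Q * P = 1\<^sub>m (dim UNIV)"
    and conj: "\<And>T Y Z. Vector_Spaces.linear scale scale T \<Longrightarrow> represents v Y T \<Longrightarrow>
      represents v' Z T \<Longrightarrow> Y * P = P * Z \<and> Q * Y = Z * Q"
    by (rule change_of_basis[OF v v']) (rule that)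
  have "Z \<in> carrier_mat (dim UNIV) (dim UNIV)" using Z(1) by (simp add: represents_def)
  from tridiagonal_eigenvalues_distinct[OF this Z(2) PQ(1,2,4) conj[OF lin Z(1) D, THEN conjunct1]] show ?thesis .
qed

text \<open>Both \<open>f\<close>, from the first split basis, and \<open>g\<close>, from the second, belong to the eigenvalue \<open>t 0\<close>: it is
  the first entry of the order \<open>t\<close> and the last entry of the reversed order. Their consecutive
  ratios carry \<open>p j\<close> and \<open>p' j\<close>, and \<open>tridiagonal_left_right_eigenvector\<close> combines them.\<close>

lemma tridiagonal_entries_from_split_sequences:
  fixes t t' p p' :: "nat \<Rightarrow> 'a" and Y
  assumes A: "Vector_Spaces.linear scale scale A" and A': "Vector_Spaces.linear scale scale A'"
    and v': "ordered_basis v'" and D: "represents v' (mat_diag (dim UNIV) t') A'"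
    and Y: "represents v' Y A" "irreducible_tridiagonal Y"
    and inj: "inj_on t' {..<dim (UNIV :: 'b set)}"
    and p: "first_split_sequence A A' t t' p" and p': "second_split_sequence A A' t t' p'"
    and j: "1 \<le> j" "j < dim (UNIV :: 'b set)"
  shows "Y $$ (j - 1, j) * Y $$ (j, j - 1) *
      (\<Prod>h<j. t' j - t' h) * (\<Prod>h\<in>{j - 1<..dim (UNIV :: 'b set) - 1}. t' (j - 1) - t' h) =
    p j * p' j *
      (\<Prod>h<j - 1. t' (j - 1) - t' h) * (\<Prod>h\<in>{j<..dim (UNIV :: 'b set) - 1}. t' j - t' h)"
proof -
  let ?n = "dim (UNIV :: 'b set)"
  let ?s = "\<lambda>i. t (?n - 1 - i)"
  have Yc: "Y \<in> carrier_mat ?n ?n" using Y(1) by (simp add: represents_def)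
  obtain u where u: "ordered_basis u" "represents u (lower_bidiag ?n t) A"
      "represents u (upper_bidiag ?n t' p) A'"
    using p unfolding first_split_sequence_def by blast
  have p0: "\<forall>i\<in>{1..<?n}. p i \<noteq> 0"
    using p by (auto simp: first_split_sequence_def)
  obtain P Q where P: "P \<in> carrier_mat ?n ?n" and Q: "Q \<in> carrier_mat ?n ?n"
    and PQ: "P * Q = 1\<^sub>m ?n" and QP: "Q * P = 1\<^sub>m ?n"
    and conj: "\<And>T Y Z. Vector_Spaces.linear scale scale T \<Longrightarrow> represents v' Y T \<Longrightarrow>
      represents u Z T \<Longrightarrow> Y * P = P * Z \<and> Q * Y = Z * Q"
    by (rule change_of_basis[OF v' u(1)]) (rule that)
  obtain f where f: "\<And>j. j < ?n \<Longrightarrow> (\<Sum>k<?n. f k * Y $$ (k, j)) = t 0 * f j"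
    and f0: "\<And>j. j < ?n \<Longrightarrow> f j \<noteq> 0"
    and f_ratio: "\<And>j. 1 \<le> j \<Longrightarrow> j < ?n \<Longrightarrow>
      f j * Y $$ (j, j - 1) * (\<Prod>h<j. t' j - t' h) =
      p j * f (j - 1) * (\<Prod>h<j - 1. t' (j - 1) - t' h)"
    by (rule split_basis_left_eigenvector[OF Yc Y(2) P Q QP conj[OF A Y(1) u(2), THEN conjunct2]
          conj[OF A' D u(3), THEN conjunct2] inj p0]) (rule that)
  obtain w where w: "ordered_basis w" "represents w (lower_bidiag ?n ?s) A"
      "represents w (upper_bidiag ?n t' p') A'"
    using p' unfolding second_split_sequence_def first_split_sequence_def by blast
  have p'0: "\<forall>i\<in>{1..<?n}. p' i \<noteq> 0"
    using p' by (auto simp: second_split_sequence_def first_split_sequence_def)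
  obtain P' Q' where P': "P' \<in> carrier_mat ?n ?n" and Q': "Q' \<in> carrier_mat ?n ?n"
    and PQ': "P' * Q' = 1\<^sub>m ?n" and QP': "Q' * P' = 1\<^sub>m ?n"
    and conj': "\<And>T Y Z. Vector_Spaces.linear scale scale T \<Longrightarrow> represents v' Y T \<Longrightarrow>
      represents w Z T \<Longrightarrow> Y * P' = P' * Z \<and> Q' * Y = Z * Q'"
    by (rule change_of_basis[OF v' w(1)]) (rule that)
  obtain g where g: "\<And>j. j < ?n \<Longrightarrow> (\<Sum>k<?n. Y $$ (j, k) * g k) = ?s (?n - 1) * g j"
    and g0: "\<And>j. j < ?n \<Longrightarrow> g j \<noteq> 0"
    and g_ratio: "\<And>j. 1 \<le> j \<Longrightarrow> j < ?n \<Longrightarrow>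
      g (j - 1) * Y $$ (j, j - 1) * (\<Prod>h\<in>{j - 1<..?n - 1}. t' (j - 1) - t' h) =
      p' j * g j * (\<Prod>h\<in>{j<..?n - 1}. t' j - t' h)"
    by (rule split_basis_right_eigenvector[OF Yc Y(2) P' Q' PQ' conj'[OF A Y(1) w(2), THEN conjunct1]
          conj'[OF A' D w(3), THEN conjunct1] inj p'0]) (rule that)
  have cross: "f j * g (j - 1) * Y $$ (j, j - 1) = Y $$ (j - 1, j) * f (j - 1) * g j"
    using tridiagonal_left_right_eigenvector[OF Yc Y(2) f, of g "j - 1"] g j by simp
  have cancel: "x * y * a * b = c * e * r * s"
    if "k * l' * y = x * k' * l" "k * y * a = c * k' * r" "l' * y * b = e * l * s" "k' * l \<noteq> 0"
    for a b c e k k' l l' r s x y :: 'a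
  proof -
    have "(k' * l) * (x * y * a * b) = (k * l' * y) * y * a * b"
      unfolding that(1) by (simp only: mult_ac)
    also have "\<dots> = (k * y * a) * (l' * y * b)" by (simp only: mult_ac)
    also have "\<dots> = (k' * l) * (c * e * r * s)" unfolding that(2,3) by (simp only: mult_ac)
    finally show ?thesis by (rule mult_left_cancel[OF that(4), THEN iffD1])
  qed
  show ?thesis
    by (rule cancel[OF cross f_ratio[OF j] g_ratio[OF j]]) (use f0 g0 j in simp)
qed

end


theorem theorem1p10:
  fixes scale :: "'a::field \<Rightarrow> 'v::ab_group_add \<Rightarrow> 'v"
    and Bs :: "'v set"
    and A A' :: "'v \<Rightarrow> 'v"
    and v v' :: "nat \<Rightarrow> 'v"
    and \<theta> \<theta>' \<phi>\<^sub>1 \<phi>\<^sub>2 :: "nat \<Rightarrow> 'a"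
    and \<beta> :: 'a
    and q :: "'a alg_closure"
    and d :: nat
  assumes V: "finite_dimensional_vector_space scale Bs"
    and dim_pos: "vector_space.dim scale (UNIV :: 'v set) > 0"
    and d_def: "d = vector_space.dim scale (UNIV :: 'v set) - 1"
    and pair: "linear_space.leonard_pair scale A A'"
    and basis_i: "linear_space.tridiagonal_diagonal_basis scale A A' v'"
    and eigenvalues_A': "linear_space.represents scale v' (mat_diag (d + 1) \<theta>') A'"
    and basis_ii: "linear_space.tridiagonal_diagonal_basis scale A' A v"
    and eigenvalues_A: "linear_space.represents scale v (mat_diag (d + 1) \<theta>) A"
    and first_split: "linear_space.first_split_sequence scale A A' \<theta> \<theta>' \<phi>\<^sub>1"
    and second_split: "linear_space.second_split_sequence scale A A' \<theta> \<theta>' \<phi>\<^sub>2"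
    and beta: "d \<ge> 3 \<Longrightarrow> \<forall>i \<in> {2..d - 1}.
        \<beta> + 1 = (\<theta> (i - 2) - \<theta> (i + 1)) / (\<theta> (i - 1) - \<theta> i) \<and>
        \<beta> + 1 = (\<theta>' (i - 2) - \<theta>' (i + 1)) / (\<theta>' (i - 1) - \<theta>' i)"
    and q_nonzero: "q \<noteq> 0"
    and q_beta: "to_ac \<beta> = q powi 2 + q powi (- 2)"
    and d_odd: "odd d"
  shows "to_ac (linear_space.lin_det scale (\<lambda>x. A (A' x) - A' (A x))) =
    (- 1) ^ ((d + 1) div 2) *
    (\<Prod>i \<in> {i. 1 \<le> i \<and> i \<le> d \<and> odd i}. to_ac (\<phi>\<^sub>1 i * \<phi>\<^sub>2 i) / (q_bracket q i)\<^sup>2)"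
proof -
  interpret finite_dimensional_vector_space scale Bs by (rule V)
  interpret linear_space scale by unfold_locales
  obtain m where m: "d = 2 * m + 1" using d_odd by (auto elim: oddE)
  have n: "dim (UNIV :: 'v set) = 2 * (m + 1)" using d_def dim_pos m by simp
  have A: "Vector_Spaces.linear scale scale A" and A': "Vector_Spaces.linear scale scale A'"
    using pair by (auto simp: leonard_pair_def)
  have D: "represents v' (mat_diag (dim UNIV) \<theta>') A'" using eigenvalues_A' n m by simp
  obtain Y where v': "ordered_basis v'" and Y: "represents v' Y A" "irreducible_tridiagonal Y"
    using basis_i by (auto simp: tridiagonal_diagonal_basis_def)
  have Yc: "Y \<in> carrier_mat (2 * (m + 1)) (2 * (m + 1))"
    using Y(1) unfolding represents_def n by blast
  have inj: "inj_on \<theta>' {..<dim (UNIV :: 'v set)}"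
    by (rule leonard_pair_eigenvalues_distinct[OF A' basis_ii v' D])
  define R where "R i = (\<theta>' i - \<theta>' (i - 1))\<^sup>2 * (Y $$ (i - 1, i) * Y $$ (i, i - 1))" for i
  let ?F = "gap_factor \<beta>"

  have "lin_det (\<lambda>x. A (A' x) - A' (A x)) =
      det (mat (2 * (m + 1)) (2 * (m + 1)) (\<lambda>(i, j). (\<theta>' j - \<theta>' i) * Y $$ (i, j)))"
    using lin_det_eq[OF linear_commutator[OF A A'] v' represents_commutator[OF A A' Y(1) D]]
    by (simp only: n)
  also have "\<dots> = (\<Prod>k<m + 1. - ((\<theta>' (2 * k + 1) - \<theta>' (2 * k)) * Y $$ (2 * k, 2 * k + 1) *
      ((\<theta>' (2 * k) - \<theta>' (2 * k + 1)) * Y $$ (2 * k + 1, 2 * k))))"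
    using irreducible_tridiagonalD(1)[OF Y(2) Yc] by (intro det_tridiagonal_zero_diagonal) auto
  also have "\<dots> = (\<Prod>k<m + 1. R (2 * k + 1))"
    by (intro prod.cong) (simp_all add: R_def power2_eq_square algebra_simps)
  finally have det: "lin_det (\<lambda>x. A (A' x) - A' (A x)) = (\<Prod>k<m + 1. R (2 * k + 1))" .

  have inj': "inj_on \<theta>' {..2 * m + 1}" using inj n by (simp add: lessThan_Suc_atMost)
  have rec: "\<theta>' (i - 2) - \<theta>' (i + 1) = (\<beta> + 1) * (\<theta>' (i - 1) - \<theta>' i)" if "2 \<le> i" "i \<le> 2 * m" for i
  proof -
    have "i - 1 \<in> {..2 * m + 1}" "i \<in> {..2 * m + 1}" "i - 1 \<noteq> i" using that by auto
    then have "\<theta>' (i - 1) \<noteq> \<theta>' i" using inj_onD[OF inj'] by blast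
    moreover have "\<beta> + 1 = (\<theta>' (i - 2) - \<theta>' (i + 1)) / (\<theta>' (i - 1) - \<theta>' i)"
    proof -
      have "d \<ge> 3" "i \<in> {2..d - 1}" using that m by auto
      then show ?thesis using beta by blast
    qed
    ultimately show ?thesis by simp
  qed
  have R: "R i * (\<Prod>h<i. \<theta>' i - \<theta>' h) * (\<Prod>h\<in>{i - 1<..2 * m + 1}. \<theta>' (i - 1) - \<theta>' h) =
      \<phi>\<^sub>1 i * \<phi>\<^sub>2 i * (\<theta>' i - \<theta>' (i - 1))\<^sup>2 *
        (\<Prod>h<i - 1. \<theta>' (i - 1) - \<theta>' h) * (\<Prod>h\<in>{i<..2 * m + 1}. \<theta>' i - \<theta>' h)"
    if "1 \<le> i" "i \<le> 2 * m + 1" for i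
  proof -
    have nat: "2 * (m + 1) - 1 = 2 * m + 1" "i < 2 * (m + 1)" using that by simp_all
    have scale: "g * (x * y) * a * b = c * e * g * r * s" if "x * y * a * b = c * e * r * s"
      for a b c e g r s x y :: 'a
      using that by Groebner_Basis.algebra
    show ?thesis unfolding R_def
      by (rule scale[OF tridiagonal_entries_from_split_sequences[OF A A' v' D Y inj
              first_split second_split, unfolded n nat(1), OF that(1) nat(2)]])
  qed
  have "(\<Prod>k<m + 1. R (2 * k + 1)) * (\<Prod>k<m + 1. (?F (2 * k + 1))\<^sup>2) =
      (\<Prod>k<m + 1. - (\<phi>\<^sub>1 (2 * k + 1) * \<phi>\<^sub>2 (2 * k + 1)))"
    by (rule prod_odd_eigenvalue_ratios(1)[OF inj' rec R])
  moreover have "(\<Prod>k<m + 1. (?F (2 * k + 1))\<^sup>2) \<noteq> 0"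
    using prod_odd_eigenvalue_ratios(2)[OF inj' rec R] by auto
  ultimately have "(\<Prod>k<m + 1. R (2 * k + 1)) =
      (\<Prod>k<m + 1. - (\<phi>\<^sub>1 (2 * k + 1) * \<phi>\<^sub>2 (2 * k + 1))) / (\<Prod>k<m + 1. (?F (2 * k + 1))\<^sup>2)"
    by (simp only: nonzero_eq_divide_eq not_False_eq_True)
  also have "\<dots> = (- 1) ^ (m + 1) *
      (\<Prod>k<m + 1. \<phi>\<^sub>1 (2 * k + 1) * \<phi>\<^sub>2 (2 * k + 1) / (?F (2 * k + 1))\<^sup>2)"
    by (simp only: prod_uminus prod_dividef card_lessThan times_divide_eq_right)
  finally have "to_ac (\<Prod>k<m + 1. R (2 * k + 1)) = (- 1) ^ (m + 1) *
      (\<Prod>k<m + 1. to_ac (\<phi>\<^sub>1 (2 * k + 1) * \<phi>\<^sub>2 (2 * k + 1)) / (q_bracket q (2 * k + 1))\<^sup>2)"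
    by (simp add: to_ac_prod to_ac_gap_factor_odd[OF q_nonzero q_beta] del: prod.lessThan_Suc)
  also have "(\<Prod>k<m + 1. to_ac (\<phi>\<^sub>1 (2 * k + 1) * \<phi>\<^sub>2 (2 * k + 1)) / (q_bracket q (2 * k + 1))\<^sup>2) =
      (\<Prod>i\<in>{i. 1 \<le> i \<and> i \<le> d \<and> odd i}. to_ac (\<phi>\<^sub>1 i * \<phi>\<^sub>2 i) / (q_bracket q i)\<^sup>2)"
    by (rule prod.reindex_bij_witness[of _ "\<lambda>i. i div 2" "\<lambda>k. 2 * k + 1"]) (auto simp: m elim: oddE)
  finally have "to_ac (\<Prod>k<m + 1. R (2 * k + 1)) = (- 1) ^ (m + 1) *
      (\<Prod>i\<in>{i. 1 \<le> i \<and> i \<le> d \<and> odd i}. to_ac (\<phi>\<^sub>1 i * \<phi>\<^sub>2 i) / (q_bracket q i)\<^sup>2)" .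
  moreover have half: "(d + 1) div 2 = m + 1" using m by simp
  ultimately show ?thesis unfolding det half by blast
qed

end
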